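(* Let $d\geq 1$, let $\mathcal S=\{\sigma\in L(\mathbb C^d):\sigma\geq 0,\ \mathrm{Tr}(\sigma)=1\}$, and let $\mathrm d\rho$ be any probability measure on $\mathcal S$. Then for every $\sigma\in\mathcal S$, $$\mathbb E_\rho[F(\rho,\sigma)]\leq\frac1d\left(1+\sqrt{d-1}\,\sqrt{d\left(\mathbb E_\rho\Big[\sqrt{1-\mathrm{Tr}(\rho^2)}\Big]^2+\mathrm{Tr}\big(\mathbb E_\rho[\rho]^2\big)\right)-1}\right).$$
   Context: The fidelity of $\rho,\sigma\in\mathcal S$ is $F(\rho,\sigma)=\big[\mathrm{Tr}\sqrt{\sqrt\rho\,\sigma\sqrt\rho}\big]^2$. $\mathbb E_\rho$ denotes expectation with respect to $\mathrm d\rho$. *)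

theory Defs
  imports "HOL-Analysis.Analysis" "HOL-Probability.Probability"
begin

text \<open>Matrices on C^d are complex^'n^'n with d = CARD('n).
  Positive semidefinite: v* A v \<ge> 0 for all v \<in> C^d (as a complex number).\<close>

definition psd :: "complex^'n^'n \<Rightarrow> bool" where
  "psd A \<longleftrightarrow> (\<forall>v::complex^'n. (\<Sum>i\<in>UNIV. \<Sum>j\<in>UNIV. cnj (v$i) * A$i$j * v$j) \<in> \<real>
                                \<and> 0 \<le> Re (\<Sum>i\<in>UNIV. \<Sum>j\<in>UNIV. cnj (v$i) * A$i$j * v$j))"

definition density_matrices :: "(complex^'n^'n) set" where
  "density_matrices = {\<sigma>. psd \<sigma> \<and> trace \<sigma> = 1}"

definition msqrt :: "complex^'n^'n \<Rightarrow> complex^'n^'n" where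
  "msqrt A = (THE B. psd B \<and> B ** B = A)"

definition fidelity :: "complex^'n^'n \<Rightarrow> complex^'n^'n \<Rightarrow> real" where
  "fidelity \<rho> \<sigma> = (Re (trace (msqrt (msqrt \<rho> ** \<sigma> ** msqrt \<rho>)))) ^ 2"

end

theory Submission
  imports Defs
begin

text \<open>The heart of the matter is the super-fidelity bound
  $F(\rho,\sigma) \le \mathrm{Tr}(\rho\sigma) + \sqrt{1 - \mathrm{Tr}\,\rho^2}\sqrt{1 - \mathrm{Tr}\,\sigma^2}$.
  By polar decomposition there is a unitary $U$ with $X = \sqrt\rho\sqrt\sigma\,U \ge 0$, so that $X$ is the
  square root of $\sqrt\rho\,\sigma\sqrt\rho$ and $F = (\mathrm{Tr}\,X)^2$. Now
  $(\mathrm{Tr}\,X)^2 - \mathrm{Tr}\,X^2$ is twice the trace of the second compound matrix of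
  $X = \sqrt\rho \cdot (\sqrt\sigma\,U)$; compounds are multiplicative, so Cauchy--Schwarz for the
  Hilbert--Schmidt inner product of the two compounds gives the bound. The unitary $U$ is found as a maximiser
  of $\mathrm{Re}\,\mathrm{Tr}(BU)$: comparing $U$ with $U(1 + (z-1)vv^*)$, $|z| = 1$, forces $v^*BUv \ge 0$.

  Averaging the bound, splitting off the traceless parts of $\mathbb{E}[\rho]$ and $\sigma$, and applying
  Cauchy--Schwarz twice more gives the theorem; $\mathrm{Tr}\,\sigma^2$ cancels in the last step.\<close>

section \<open>Hermitian inner product, adjoints and rank-one matrices\<close>

definition cinner :: "complex^'n \<Rightarrow> complex^'n \<Rightarrow> complex" where
  "cinner x y = (\<Sum>i\<in>UNIV. cnj (x$i) * y$i)"

definition adj :: "complex^'n^'m \<Rightarrow> complex^'m^'n" where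
  "adj A = (\<chi> i j. cnj (A$j$i))"

definition outer :: "complex^'m \<Rightarrow> complex^'n \<Rightarrow> complex^'n^'m" where
  "outer x y = (\<chi> i j. x$i * cnj (y$j))"

text \<open>For square matrices a right inverse is two-sided, so one equation suffices.\<close>

definition unitary :: "complex^'n^'n \<Rightarrow> bool" where
  "unitary U \<longleftrightarrow> U ** adj U = mat 1"

lemma cinner_add_left: "cinner (x + y) z = cinner x z + cinner y z"
  by (simp add: cinner_def sum.distrib algebra_simps)

lemma cinner_add_right: "cinner x (y + z) = cinner x y + cinner x z"
  by (simp add: cinner_def sum.distrib algebra_simps)

lemma cinner_diff_right: "cinner x (y - z) = cinner x y - cinner x z"
  by (simp add: cinner_def sum_subtractf algebra_simps)

lemma cinner_scale_left: "cinner (c *s x) y = cnj c * cinner x y"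
  by (simp add: cinner_def sum_distrib_left algebra_simps)

lemma cinner_scale_right: "cinner x (c *s y) = c * cinner x y"
  by (simp add: cinner_def sum_distrib_left algebra_simps)

lemmas cinner_simps = cinner_add_left cinner_add_right cinner_scale_left cinner_scale_right

lemma cnj_cinner: "cnj (cinner x y) = cinner y x"
  by (simp add: cinner_def mult.commute)

lemma cinner_self: "cinner x x = of_real ((norm x)\<^sup>2)"
proof -
  have "cinner x x = (\<Sum>i\<in>UNIV. of_real ((norm (x$i))\<^sup>2))"
    unfolding cinner_def by (intro sum.cong refl) (metis complex_norm_square mult.commute)
  then show ?thesis
    by (simp add: norm_vec_def L2_set_def sum_nonneg)
qed

lemma cinner_axis_left: "cinner (axis k 1) x = x$k"
  by (simp add: cinner_def axis_def if_distrib[of cnj] if_distrib[of "\<lambda>a. a * _"] cong: if_cong)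

lemma matrix_vector_axis: "(A *v axis k 1) $ i = (A$i$k :: complex)"
  by (simp add: matrix_vector_mult_def axis_def if_distrib cong: if_cong)

lemma cinner_adj: "cinner x (A *v y) = cinner (adj A *v x) y"
proof -
  have "cinner x (A *v y) = (\<Sum>i\<in>UNIV. \<Sum>j\<in>UNIV. cnj (x$i) * A$i$j * y$j)"
    by (simp add: cinner_def matrix_vector_mult_def sum_distrib_left mult.assoc)
  also have "\<dots> = (\<Sum>j\<in>UNIV. \<Sum>i\<in>UNIV. cnj (x$i) * A$i$j * y$j)"
    by (rule sum.swap)
  also have "\<dots> = cinner (adj A *v x) y"
    by (simp add: cinner_def matrix_vector_mult_def adj_def sum_distrib_left sum_distrib_right mult_ac)
  finally show ?thesis .
qed

lemma matrix_add_rdistrib': "(A + B) ** C = A ** C + B ** (C :: complex^'n^'m)"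
  by (simp add: matrix_matrix_mult_def vec_eq_iff sum.distrib algebra_simps)

lemma matrix_diff_ldistrib: "A ** (B - C) = A ** B - A ** (C :: complex^'n^'m)"
  by (simp add: matrix_matrix_mult_def vec_eq_iff sum_subtractf algebra_simps)

lemma matrix_diff_rdistrib: "(A - B) ** C = A ** C - B ** (C :: complex^'n^'m)"
  by (simp add: matrix_matrix_mult_def vec_eq_iff sum_subtractf algebra_simps)

lemma adj_adj [simp]: "adj (adj A) = A"
  by (simp add: adj_def vec_eq_iff)

lemma adj_mult: "adj (A ** B) = adj B ** adj A"
  by (simp add: adj_def vec_eq_iff matrix_matrix_mult_def mult.commute)

lemma adj_add: "adj (A + B) = adj A + adj B"
  by (simp add: adj_def vec_eq_iff)

lemma adj_diff: "adj (A - B) = adj A - adj B"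
  by (simp add: adj_def vec_eq_iff)

lemma adj_0 [simp]: "adj 0 = 0"
  by (simp add: adj_def vec_eq_iff)

lemma adj_mat_1 [simp]: "adj (mat 1) = mat 1"
  by (auto simp add: adj_def vec_eq_iff mat_def)

lemma adj_outer: "adj (outer x y) = outer y x"
  by (simp add: adj_def outer_def vec_eq_iff mult.commute)

lemma outer_mult: "outer w x ** outer y z = outer (cinner x y *s w) z"
  by (simp add: outer_def vec_eq_iff matrix_matrix_mult_def cinner_def sum_distrib_left
      sum_distrib_right mult_ac)

lemma outer_vec: "outer x y *v z = cinner y z *s x"
  by (simp add: outer_def vec_eq_iff matrix_vector_mult_def cinner_def sum_distrib_left
      sum_distrib_right mult_ac)

lemma trace_mult_outer: "trace (A ** outer x y) = cinner y (A *v x)"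
  by (simp add: outer_def trace_def matrix_matrix_mult_def matrix_vector_mult_def cinner_def
      sum_distrib_left sum_distrib_right mult_ac)

text \<open>The norm of the nested vector type is the Hilbert-Schmidt norm. This turns a vanishing
  trace into a vanishing matrix.\<close>

lemma trace_mult_adj: "trace (A ** adj A) = of_real ((norm A)\<^sup>2)"
proof -
  have "trace (A ** adj A) = (\<Sum>i\<in>UNIV. cinner (A$i) (A$i))"
    by (simp add: trace_def matrix_matrix_mult_def adj_def cinner_def mult.commute)
  then show ?thesis
    by (simp add: cinner_self norm_vec_def[of A] L2_set_def sum_nonneg)
qed

section \<open>Unitary matrices and polar decomposition\<close>

text \<open>Closed as the preimage of a point; bounded because each unitary has squared norm equal
  to the dimension. Compactness supplies the maximiser in \<open>polar\<close>.\<close>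

lemma unitary_compact: "compact {U :: complex^'n^'n. unitary U}"
proof -
  have cont: "continuous_on UNIV (\<lambda>U :: complex^'n^'n. U ** adj U)"
    unfolding matrix_matrix_mult_def adj_def by (intro continuous_intros)
  have "{U :: complex^'n^'n. unitary U} = (\<lambda>U. U ** adj U) -` {mat 1}"
    by (auto simp: unitary_def)
  then have "closed {U :: complex^'n^'n. unitary U}"
    using cont by (simp add: continuous_on_closed_vimage)
  moreover have "norm U \<le> sqrt (real CARD('n))" if "unitary U" for U :: "complex^'n^'n"
  proof -
    have "(of_real ((norm U)\<^sup>2) :: complex) = of_nat CARD('n)"
      using that by (simp add: trace_mult_adj[symmetric] unitary_def trace_I del: of_real_power)
    then have "(norm U)\<^sup>2 = real CARD('n)"
      by (metis of_real_eq_iff of_real_of_nat_eq)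
    then show ?thesis
      by (metis norm_ge_zero order_refl real_sqrt_unique)
  qed
  then have "bounded {U :: complex^'n^'n. unitary U}"
    by (auto simp: bounded_iff)
  ultimately show ?thesis
    by (simp add: compact_eq_bounded_closed)
qed

lemma unitary_mult: "unitary U \<Longrightarrow> unitary V \<Longrightarrow> unitary (U ** V)"
  unfolding unitary_def adj_mult by (metis matrix_mul_assoc matrix_mul_rid)

text \<open>The matrix multiplies \<open>v\<close> by \<open>z\<close> and fixes its orthogonal
  complement. With \<open>c = z - 1\<close>, the defect from unitarity is
  \<open>c + cnj c + c * cnj c\<close>, that is, |z|^2 - 1.\<close>

lemma unitary_phase:
  assumes "norm v = 1" "norm z = 1"
  shows "unitary (mat 1 + outer ((z - 1) *s v) v)"
proof -
  define c where "c = z - 1"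
  have v: "cinner v v = 1" using assms by (simp add: cinner_self)
  have "z * cnj z = 1" using assms by (simp add: complex_norm_square[symmetric])
  then have c0: "c + (cnj c + c * cnj c) = 0" by (simp add: c_def algebra_simps)
  have "outer (c *s v) v ** outer v (c *s v) = outer ((c * cnj c) *s v) v"
    by (simp add: outer_mult v) (simp add: outer_def vec_eq_iff mult_ac)
  moreover have "outer v (c *s v) = outer (cnj c *s v) v"
    by (simp add: outer_def vec_eq_iff mult_ac)
  ultimately have "(mat 1 + outer (c *s v) v) ** adj (mat 1 + outer (c *s v) v) =
     mat 1 + outer ((c + (cnj c + c * cnj c)) *s v) v"
    by (simp add: adj_add adj_outer matrix_add_ldistrib matrix_add_rdistrib')
      (simp add: outer_def vec_eq_iff algebra_simps)
  then show ?thesis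
    unfolding unitary_def c_def[symmetric] c0 by (simp add: outer_def vec_eq_iff)
qed

lemma psd_iff: "psd A \<longleftrightarrow> (\<forall>v. cinner v (A *v v) \<in> \<real> \<and> 0 \<le> Re (cinner v (A *v v)))"
proof -
  have "cinner v (A *v v) = (\<Sum>i\<in>UNIV. \<Sum>j\<in>UNIV. cnj (v$i) * A$i$j * v$j)" for v
    by (simp add: cinner_def matrix_vector_mult_def sum_distrib_left mult.assoc)
  then show ?thesis by (simp add: psd_def)
qed

lemma psd_Re: "psd A \<Longrightarrow> 0 \<le> Re (cinner v (A *v v))"
  by (simp add: psd_iff)

lemma psd_of_real: "psd A \<Longrightarrow> cinner v (A *v v) = of_real (Re (cinner v (A *v v)))"
  by (simp add: psd_iff)

lemma polar:
  fixes B :: "complex^'n^'n"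
  obtains U where "unitary U" "psd (B ** U)"
proof -
  let ?S = "{U :: complex^'n^'n. unitary U}"
  have "continuous_on ?S (\<lambda>U. Re (trace (B ** U)))"
    unfolding matrix_matrix_mult_def trace_def by (intro continuous_intros)
  moreover have "mat 1 \<in> ?S" by (simp add: unitary_def)
  ultimately obtain U where U: "unitary U"
    and max: "\<And>V. unitary V \<Longrightarrow> Re (trace (B ** V)) \<le> Re (trace (B ** U))"
    using continuous_attains_sup[OF unitary_compact, of "\<lambda>U. Re (trace (B ** U))"] by blast
  let ?X = "B ** U"
  have unit: "cinner v (?X *v v) = of_real (norm (cinner v (?X *v v)))" if v: "norm v = 1" for v
  proof -
    define w where "w = cinner v (?X *v v)"
    \<comment> \<open>The phase that rotates \<open>w\<close> onto the nonnegative real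
      axis.\<close>
    define z where "z = (if w = 0 then 1 else cnj w / norm w)"
    have z: "norm z = 1" by (simp add: z_def norm_divide)
    have zw: "z * w = norm w"
    proof (cases "w = 0")
      case False
      then show ?thesis
        using complex_norm_square[of w] by (simp add: z_def field_simps power2_eq_square)
    qed (simp add: z_def)
    let ?V = "mat 1 + outer ((z - 1) *s v) v"
    have "B ** (U ** ?V) = ?X + ?X ** outer ((z - 1) *s v) v"
      by (simp add: matrix_mul_assoc matrix_add_ldistrib)
    then have "trace (B ** (U ** ?V)) = trace ?X + (z - 1) * w"
      by (simp only: trace_add trace_mult_outer w_def vector_scalar_commute cinner_simps)
    \<comment> \<open>Perturbing \<open>U\<close> by this phase changes the trace by
      \<open>(z - 1) * w\<close>, whose real part is |w| - Re w. Maximality thus forces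
      \<open>w\<close> to be real and nonnegative.\<close>
    then have "Re ((z - 1) * w) \<le> 0"
      using max[OF unitary_mult[OF U unitary_phase[OF v z]]] by simp
    then have "norm w \<le> Re w"
      by (simp add: left_diff_distrib zw)
    then show ?thesis
      using complex_Re_le_cmod[of w] by (simp add: w_def[symmetric] complex_eq_iff)
        (smt (verit) cmod_power2 power2_eq_square mult_eq_0_iff zero_less_power2)
  qed
  have "cinner v (?X *v v) \<in> \<real> \<and> 0 \<le> Re (cinner v (?X *v v))" for v
  proof (cases "v = 0")
    case False
    \<comment> \<open>The quadratic form scales by the squared norm, so unit vectors decide its
      sign.\<close>
    define u where "u = complex_of_real (inverse (norm v)) *s v"
    have nu: "norm u = 1"
    proof -
      have "u = inverse (norm v) *\<^sub>R v" by (simp add: u_def vec_eq_iff scaleR_conv_of_real[where 'a = complex])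
      with False show ?thesis by simp
    qed
    have "v = complex_of_real (norm v) *s u" using False by (simp add: u_def vec_eq_iff)
    then have "cinner v (?X *v v) = of_real ((norm v)\<^sup>2) * cinner u (?X *v u)"
      by (metis (no_types, lifting) cinner_scale_left cinner_scale_right complex_cnj_complex_of_real
        mult.assoc of_real_mult power2_eq_square vector_scalar_commute)
    also have "\<dots> = of_real ((norm v)\<^sup>2 * norm (cinner u (?X *v u)))"
      using unit[OF nu] by (metis of_real_mult)
    finally show ?thesis by simp
  qed (simp add: cinner_def)
  then have "psd ?X" by (simp add: psd_iff)
  with U show thesis by (rule that)
qed

section \<open>Positive semidefinite matrices: Cauchy-Schwarz and factorisation\<close>

text \<open>Polarisation: reality of the form at \<open>x + y\<close> settles the imaginary parts,
  and at \<open>x + \<i> *s y\<close> the real parts.\<close>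

lemma psd_swap:
  assumes "psd A"
  shows "cinner y (A *v x) = cnj (cinner x (A *v y))"
proof -
  have re: "Im (cinner v (A *v v)) = 0" for v
    using assms by (simp add: psd_iff complex_is_Real_iff)
  have "Im (cinner x (A *v y)) + Im (cinner y (A *v x)) = 0"
    using re[of "x + y"] re[of x] re[of y] by (simp add: cinner_simps matrix_vector_right_distrib)
  moreover have "Re (cinner x (A *v y)) - Re (cinner y (A *v x)) = 0"
    using re[of "x + \<i> *s y"] re[of x] re[of y]
    by (simp add: cinner_simps matrix_vector_right_distrib vector_scalar_commute)
  ultimately show ?thesis by (simp add: complex_eq_iff)
qed

lemma psd_adj: "psd A \<Longrightarrow> adj A = A"
proof -
  assume A: "psd A"
  have "A$i$j = cnj (A$j$i)" for i j
    using psd_swap[OF A, of "axis i 1" "axis j 1"] by (simp add: cinner_axis_left matrix_vector_axis)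
  then show ?thesis by (metis (no_types, lifting) adj_def vec_eq_iff vec_lambda_beta)
qed

lemma psd_Cauchy_Schwarz:
  assumes A: "psd A"
  shows "(norm (cinner x (A *v y)))\<^sup>2 \<le> Re (cinner x (A *v x)) * Re (cinner y (A *v y))"
proof -
  define c where "c = cinner y (A *v x)"
  define a b m where "a = Re (cinner x (A *v x))" and "b = Re (cinner y (A *v y))"
    and "m = (norm c)\<^sup>2"
  have c': "cinner x (A *v y) = cnj c" unfolding c_def by (rule psd_swap[OF A])
  have cc: "c * cnj c = of_real m" by (simp add: m_def complex_norm_square[symmetric])
  \<comment> \<open>The form is evaluated at \<open>x - t c y\<close>; the factor \<open>c\<close>
    cancels the phase of the cross terms and leaves a real quadratic in \<open>t\<close>.\<close>
  have quad: "0 \<le> a - 2 * t * m + t\<^sup>2 * m * b" for t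
  proof -
    let ?s = "- of_real t * c"
    have "cinner (x + ?s *s y) (A *v (x + ?s *s y)) =
        cinner x (A *v x) - 2 * of_real t * (c * cnj c) + (of_real t)\<^sup>2 * (c * cnj c) * cinner y (A *v y)"
      by (simp only: cinner_simps matrix_vector_right_distrib vector_scalar_commute
          c_def[symmetric] c' complex_cnj_mult complex_cnj_minus complex_cnj_complex_of_real)
        (simp add: algebra_simps power2_eq_square)
    also have "\<dots> = of_real (a - 2 * t * m + t\<^sup>2 * m * b)"
      using psd_of_real[OF A, of x] psd_of_real[OF A, of y] cc by (simp add: a_def b_def)
    finally show ?thesis using psd_Re[OF A] by (metis Re_complex_of_real)
  qed
  have "m \<le> a * b"
  proof (cases "b = 0")
    case True
    \<comment> \<open>If \<open>b = 0\<close> and \<open>m\<close> were positive, this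
      \<open>t\<close> would give the quadratic the value -1.\<close>
    then show ?thesis using quad[of "(a + 1) / (2 * m)"] by (cases "m = 0") (auto simp: field_simps)
  next
    case False
    then have "b > 0" using psd_Re[OF A, of y] by (simp add: b_def)
    then show ?thesis using quad[of "1 / b"] by (simp add: field_simps power2_eq_square)
  qed
  then show ?thesis by (simp add: c' m_def a_def b_def)
qed

text \<open>Cauchy-Schwarz between \<open>A *v v\<close> and \<open>v\<close> bounds the fourth
  power of the norm of \<open>A *v v\<close> by zero.\<close>

lemma psd_eq_0:
  assumes "psd A" "Re (cinner v (A *v v)) = 0"
  shows "A *v v = 0"
  using psd_Cauchy_Schwarz[OF assms(1), of "A *v v" v] assms(2) by (simp add: cinner_self)

text \<open>A Cholesky elimination, one index at a time, which also copes with zero pivots.\<close>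

lemma psd_factor:
  fixes A :: "complex^'n^'n"
  assumes "psd A"
  obtains L :: "complex^'n^'n" where "A = L ** adj L"
proof -
  \<comment> \<open>Rows of \<open>A\<close> outside \<open>S\<close> are already eliminated.
    Keeping the columns of \<open>L\<close> outside \<open>S\<close> zero reserves column
    \<open>k\<close> for the next pivot.\<close>
  have "\<exists>L :: complex^'n^'n. A = L ** adj L \<and> (\<forall>i. \<forall>j. j \<notin> S \<longrightarrow> L$i$j = 0)"
    if "finite S" "psd A" "\<forall>i. \<forall>j. i \<notin> S \<longrightarrow> A$i$j = 0" for S and A :: "complex^'n^'n"
    using that
  proof (induction S arbitrary: A)
    case empty
    then have "A = 0" by (simp add: vec_eq_iff)
    then show ?case by (intro exI[of _ 0]) simp
  next
    case (insert k S)
    note A = insert.prems(1)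
    define u where "u = A *v axis k 1"
    define a where "a = Re (u$k)"
    have uk: "u$k = of_real a"
      unfolding a_def using psd_of_real[OF A, of "axis k 1"] by (simp add: cinner_axis_left u_def)
    have u: "u$i = A$i$k" for i by (simp add: u_def matrix_vector_axis)
    have sym: "A$i$j = cnj (A$j$i)" for i j
      using psd_adj[OF A] by (metis (no_types, lifting) adj_def vec_lambda_beta)
    show ?case
    proof (cases "a = 0")
      case True
      \<comment> \<open>A zero pivot kills the whole column \<open>k\<close>, and by symmetry the
        row, so \<open>S\<close> alone suffices.\<close>
      then have "u = 0"
        using psd_eq_0[OF A, of "axis k 1"] by (simp add: cinner_axis_left u_def a_def)
      then have "A$k$j = 0" for j
        using u[of j] sym[of k j] by simp
      then have "\<forall>i. \<forall>j. i \<notin> S \<longrightarrow> A$i$j = 0"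
        using insert.prems(2) by (metis insert_iff)
      from insert.IH[OF A this] show ?thesis by blast
    next
      case False
      have "0 \<le> a"
        using psd_Re[OF A, of "axis k 1"] by (simp add: cinner_axis_left u_def a_def)
      with False have a: "0 < a" by simp
      define r where "r = complex_of_real (1 / sqrt a)"
      have rr: "r * cnj r = of_real (1 / a)"
        using a by (simp add: r_def flip: of_real_mult)
      define w where "w = r *s u"
      \<comment> \<open>the Schur complement of the pivot, as in a Cholesky step\<close>
      define A' where "A' = A - outer w w"
      have A'v: "cinner v (A' *v v) = of_real (Re (cinner v (A *v v)) - (norm (cinner u v))\<^sup>2 / a)" for v
      proof -
        have "cinner v (outer w w *v v) = (r * cnj r) * (cinner u v * cnj (cinner u v))"
          by (simp add: outer_vec w_def cinner_simps cnj_cinner)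
        also have "\<dots> = of_real ((norm (cinner u v))\<^sup>2 / a)"
          unfolding rr unfolding complex_norm_square[symmetric] by simp
        finally show ?thesis
          using psd_of_real[OF A, of v]
          by (simp add: A'_def matrix_vector_mult_diff_rdistrib cinner_diff_right)
      qed
      \<comment> \<open>Cauchy-Schwarz against the pivot axis bounds exactly what the rank-one term
        subtracts.\<close>
      have "(norm (cinner u v))\<^sup>2 \<le> a * Re (cinner v (A *v v))" for v
      proof -
        have "cinner u v = cinner (axis k 1) (A *v v)"
          by (simp add: u_def cinner_adj psd_adj[OF A])
        then show ?thesis
          using psd_Cauchy_Schwarz[OF A, of "axis k 1" v]
          by (simp add: a_def u_def cinner_axis_left)
      qed
      then have "psd A'"
        using a unfolding psd_iff A'v by (simp add: divide_le_eq mult.commute)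
      moreover have "A'$i$j = 0" if "i \<notin> S" for i j
      proof (cases "i = k")
        case True
        have "A'$k$j = A$k$j - (r * cnj r) * (u$k * cnj (u$j))"
          by (simp add: A'_def outer_def w_def)
        also have "\<dots> = 0"
          using a sym[of k j] unfolding rr uk u[of j] by simp
        finally show ?thesis using True by simp
      next
        case False
        then show ?thesis
          using that insert.prems(2) by (simp add: A'_def outer_def w_def u)
      qed
      ultimately obtain L where L: "A' = L ** adj L" "\<forall>i. \<forall>j. j \<notin> S \<longrightarrow> L$i$j = 0"
        using insert.IH[of A'] by blast
      \<comment> \<open>This places \<open>w\<close> in column \<open>k\<close>, where
        \<open>L\<close> is zero, so both cross terms vanish.\<close>
      let ?K = "outer w (axis k 1)"
      have LK: "L ** adj ?K = 0"
        unfolding adj_outer using L(2) insert.hyps(2)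
        by (auto simp: vec_eq_iff matrix_matrix_mult_def outer_def axis_def intro!: sum.neutral)
      then have KL: "?K ** adj L = 0"
        by (metis adj_adj adj_mult adj_0)
      have "cinner (axis k 1) (axis k 1) = 1" by (simp add: cinner_self)
      then have KK: "?K ** adj ?K = outer w w"
        by (simp add: adj_outer outer_mult)
      have "(L + ?K) ** adj (L + ?K) = A"
        using LK KL KK
        by (simp add: adj_add matrix_add_ldistrib matrix_add_rdistrib' L(1)[symmetric])
          (simp add: A'_def)
      moreover have "(L + ?K)$i$j = 0" if "j \<notin> insert k S" for i j
        using that L(2) by (simp add: outer_def axis_def)
      ultimately show ?thesis by (metis (no_types, lifting))
    qed
  qed
  from this[of UNIV A] assms that show thesis by auto
qed

section \<open>Existence and uniqueness of the positive square root\<close>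

lemma unitary_polar_square:
  assumes "unitary U" "psd (B ** U)"
  shows "(B ** U) ** (B ** U) = B ** adj B"
proof -
  have "(B ** U) ** (B ** U) = (B ** U) ** adj (B ** U)"
    using psd_adj[OF assms(2)] by simp
  also have "\<dots> = B ** (U ** adj U) ** adj B"
    by (simp add: adj_mult matrix_mul_assoc)
  finally show ?thesis using assms(1) by (simp add: unitary_def)
qed

text \<open>Write \<open>A = L ** adj L\<close> and take the positive polar factor
  \<open>L ** U\<close>; it squares to \<open>A\<close>.\<close>

lemma psd_sqrt_exists:
  fixes A :: "complex^'n^'n"
  assumes "psd A"
  shows "\<exists>B. psd B \<and> B ** B = A"
  using assms by (metis psd_factor polar unitary_polar_square)

text \<open>With \<open>D = B - C\<close>, equal squares give \<open>D ** B + C ** D = 0\<close>.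
  Multiplying by \<open>D\<close> and taking the trace yields tr(DBD) + tr(DCD) = 0, a sum of two
  squared norms once \<open>B\<close> and \<open>C\<close> are factored. Hence \<open>D\<close>
  annihilates \<open>B\<close> and \<open>C\<close>, so \<open>D ** D = 0\<close> with
  \<open>D\<close> self-adjoint.\<close>

lemma psd_sqrt_unique:
  fixes B C :: "complex^'n^'n"
  assumes "psd B" "psd C" "B ** B = C ** C"
  shows "B = C"
proof -
  define D where "D = B - C"
  obtain L :: "complex^'n^'n" where L: "B = L ** adj L" by (rule psd_factor[OF assms(1)])
  obtain K :: "complex^'n^'n" where K: "C = K ** adj K" by (rule psd_factor[OF assms(2)])
  have adjD: "adj D = D" by (simp add: D_def adj_diff psd_adj assms)
  have "D ** B + C ** D = 0"
    using assms(3) by (simp add: D_def matrix_diff_ldistrib matrix_diff_rdistrib)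
  then have "trace (D ** (D ** B + C ** D)) = 0"
    by (simp add: trace_0[simplified])
  then have "trace (D ** (D ** B)) + trace (D ** (C ** D)) = 0"
    by (simp only: matrix_add_ldistrib trace_add)
  moreover have "trace (D ** (D ** B)) = trace ((D ** L) ** adj (D ** L))"
    by (subst trace_mul_sym) (simp add: L adj_mult adjD matrix_mul_assoc)
  moreover have "trace (D ** (C ** D)) = trace ((D ** K) ** adj (D ** K))"
    by (simp add: K adj_mult adjD matrix_mul_assoc)
  ultimately have "complex_of_real ((norm (D ** L))\<^sup>2 + (norm (D ** K))\<^sup>2) = 0"
    by (simp add: trace_mult_adj)
  then have "D ** L = 0" "D ** K = 0"
    by (simp_all only: of_real_eq_0_iff sum_power2_eq_zero_iff norm_eq_zero)
  then have "D ** B = 0" "D ** C = 0"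
    by (simp_all add: L K matrix_mul_assoc)
  then have "D ** (B - C) = 0"
    by (simp add: matrix_diff_ldistrib)
  then have "D ** adj D = 0"
    unfolding adjD by (simp add: D_def)
  then have "D = 0"
    using trace_mult_adj[of D] by (simp add: trace_0[simplified])
  then show ?thesis by (simp add: D_def)
qed

lemma msqrt_eqI: "psd B \<Longrightarrow> B ** B = A \<Longrightarrow> msqrt A = B"
  unfolding msqrt_def by (blast intro: psd_sqrt_unique)

lemma msqrt:
  assumes "psd A"
  shows "psd (msqrt A)" "msqrt A ** msqrt A = A"
  using psd_sqrt_exists[OF assms] msqrt_eqI by metis+

section \<open>Second compound matrices and the super-fidelity bound\<close>

text \<open>These are the entries of the second compound matrix, each occurring up to sign for all orderings
  of the index pairs; hence the factor 2 in the sums over all indices below.\<close>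

definition minor :: "complex^'n^'n \<Rightarrow> 'n \<Rightarrow> 'n \<Rightarrow> 'n \<Rightarrow> 'n \<Rightarrow> complex" where
  "minor A i j m n = A$i$m * A$j$n - A$i$n * A$j$m"

lemma cnj_minor: "cnj (minor A i j m n) = minor (adj A) m n i j"
  by (simp add: minor_def adj_def)

text \<open>Cauchy-Binet for 2 by 2 minors: the sum over \<open>m\<close> and \<open>n\<close> is
  twice a principal minor of \<open>A ** B\<close>, and summing those minors over \<open>i\<close>
  and \<open>j\<close> gives the squared trace minus the trace of the square.\<close>

lemma sum_minor_mult:
  fixes A B :: "complex^'n^'n"
  shows "(\<Sum>i\<in>UNIV. \<Sum>j\<in>UNIV. \<Sum>m\<in>UNIV. \<Sum>n\<in>UNIV. minor A i j m n * minor B m n i j)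
    = 2 * ((trace (A ** B))\<^sup>2 - trace ((A ** B) ** (A ** B)))"
proof -
  let ?G = "A ** B"
  have G: "(\<Sum>m\<in>UNIV. A$i$m * B$m$j) = ?G$i$j" for i j
    by (simp add: matrix_matrix_mult_def)
  have inner: "(\<Sum>m\<in>UNIV. \<Sum>n\<in>UNIV. minor A i j m n * minor B m n i j)
      = 2 * (?G$i$i * ?G$j$j - ?G$i$j * ?G$j$i)" for i j
  proof -
    \<comment> \<open>Each of the four products separates into a sum over \<open>m\<close> times a
      sum over \<open>n\<close>, both entries of \<open>A ** B\<close>.\<close>
    have "(\<Sum>m\<in>UNIV. \<Sum>n\<in>UNIV. minor A i j m n * minor B m n i j)
      = (\<Sum>m\<in>UNIV. \<Sum>n\<in>UNIV. (A$i$m * B$m$i) * (A$j$n * B$n$j))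
      - (\<Sum>m\<in>UNIV. \<Sum>n\<in>UNIV. (A$i$m * B$m$j) * (A$j$n * B$n$i))
      - (\<Sum>m\<in>UNIV. \<Sum>n\<in>UNIV. (A$j$m * B$m$i) * (A$i$n * B$n$j))
      + (\<Sum>m\<in>UNIV. \<Sum>n\<in>UNIV. (A$j$m * B$m$j) * (A$i$n * B$n$i))"
      unfolding sum.distrib[symmetric] sum_subtractf[symmetric]
      by (intro sum.cong refl) (simp add: minor_def algebra_simps)
    then show ?thesis
      by (simp add: sum_product[symmetric] G)
  qed
  have "(\<Sum>i\<in>UNIV. \<Sum>j\<in>UNIV. 2 * (?G$i$i * ?G$j$j - ?G$i$j * ?G$j$i))
      = 2 * ((\<Sum>i\<in>UNIV. \<Sum>j\<in>UNIV. ?G$i$i * ?G$j$j) - (\<Sum>i\<in>UNIV. \<Sum>j\<in>UNIV. ?G$i$j * ?G$j$i))"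
    by (simp add: sum_subtractf sum_distrib_left right_diff_distrib)
  also have "(\<Sum>i\<in>UNIV. \<Sum>j\<in>UNIV. ?G$i$i * ?G$j$j) = (trace ?G)\<^sup>2"
    by (simp add: trace_def sum_product power2_eq_square)
  also have "(\<Sum>i\<in>UNIV. \<Sum>j\<in>UNIV. ?G$i$j * ?G$j$i) = trace (?G ** ?G)"
    by (simp only: trace_def matrix_matrix_mult_def[of ?G] vec_lambda_beta)
  finally show ?thesis unfolding inner .
qed

lemma sum_mult_le_L2_set:
  fixes f g :: "'a \<Rightarrow> complex"
  shows "norm (\<Sum>x\<in>S. f x * g x) \<le> L2_set (\<lambda>x. norm (f x)) S * L2_set (\<lambda>x. norm (g x)) S"
proof -
  have "norm (\<Sum>x\<in>S. f x * g x) \<le> (\<Sum>x\<in>S. \<bar>norm (f x)\<bar> * \<bar>norm (g x)\<bar>)"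
    by (rule order_trans[OF norm_sum]) (simp add: norm_mult)
  also have "\<dots> \<le> L2_set (\<lambda>x. norm (f x)) S * L2_set (\<lambda>x. norm (g x)) S"
    by (rule L2_set_mult_ineq)
  finally show ?thesis .
qed

text \<open>Packs the four indices into one so that \<open>L2_set\<close> applies.\<close>

lemma sum_prod4:
  "(\<Sum>p\<in>UNIV. case p of (i :: 'n::finite, j :: 'n, m :: 'n, n :: 'n) \<Rightarrow> f i j m n)
    = (\<Sum>i\<in>UNIV. \<Sum>j\<in>UNIV. \<Sum>m\<in>UNIV. \<Sum>n\<in>UNIV. (f i j m n :: 'a :: comm_monoid_add))"
  by (simp only: sum.cartesian_product UNIV_Times_UNIV)

text \<open>Conjugating a minor of \<open>A\<close> gives the transposed minor of
  \<open>adj A\<close>, so this is \<open>sum_minor_mult\<close> with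
  \<open>B = adj A\<close>.\<close>

lemma norm_minors:
  fixes A :: "complex^'n^'n"
  shows "L2_set (\<lambda>p. norm (case p of (i, j, m, n) \<Rightarrow> minor A i j m n)) UNIV
    = sqrt 2 * sqrt (Re ((trace (A ** adj A))\<^sup>2 - trace ((A ** adj A) ** (A ** adj A))))"
proof -
  have sq: "(norm (minor A i j m n))\<^sup>2 = Re (minor A i j m n * minor (adj A) m n i j)" for i j m n
    unfolding cnj_minor[symmetric] complex_norm_square[symmetric] by (rule Re_complex_of_real[symmetric])
  have "(\<Sum>p\<in>UNIV. (norm (case p of (i, j, m, n) \<Rightarrow> minor A i j m n))\<^sup>2)
      = (\<Sum>p\<in>UNIV. case p of (i, j, m, n) \<Rightarrow> Re (minor A i j m n * minor (adj A) m n i j))"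
    by (intro sum.cong refl) (simp only: split_paired_all prod.case sq)
  also have "\<dots> = Re (\<Sum>i\<in>UNIV. \<Sum>j\<in>UNIV. \<Sum>m\<in>UNIV. \<Sum>n\<in>UNIV. minor A i j m n * minor (adj A) m n i j)"
    unfolding Re_sum by (rule sum_prod4)
  finally show ?thesis
    unfolding sum_minor_mult L2_set_def by (simp only: real_sqrt_mult[symmetric]) simp
qed

lemma trace_compound_Cauchy_Schwarz:
  fixes A B :: "complex^'n^'n"
  shows "norm ((trace (A ** B))\<^sup>2 - trace ((A ** B) ** (A ** B)))
    \<le> sqrt (Re ((trace (A ** adj A))\<^sup>2 - trace ((A ** adj A) ** (A ** adj A))))
      * sqrt (Re ((trace (B ** adj B))\<^sup>2 - trace ((B ** adj B) ** (B ** adj B))))"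
proof -
  let ?a = "\<lambda>p. case p of (i, j, m, n) \<Rightarrow> minor A i j m n"
  let ?b = "\<lambda>p. case p of (i, j, m, n) \<Rightarrow> minor B m n i j"
  have "2 * ((trace (A ** B))\<^sup>2 - trace ((A ** B) ** (A ** B))) = (\<Sum>p\<in>UNIV. ?a p * ?b p)"
    unfolding sum_minor_mult[symmetric] sum_prod4[symmetric] by (intro sum.cong) auto
  then have *: "norm (2 * ((trace (A ** B))\<^sup>2 - trace ((A ** B) ** (A ** B))))
      \<le> L2_set (\<lambda>p. norm (?a p)) UNIV * L2_set (\<lambda>p. norm (?b p)) UNIV"
    using sum_mult_le_L2_set[of ?a ?b UNIV] by simp
  \<comment> \<open>The index pairs of \<open>?b\<close> are transposed; passing to
    \<open>adj B\<close> restores their order up to conjugation. Cyclicity of the trace then brings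
    back \<open>B ** adj B\<close>.\<close>
  have b: "norm (?b p) = norm (case p of (i, j, m, n) \<Rightarrow> minor (adj B) i j m n)" for p
    by (auto simp: cnj_minor[symmetric] split: prod.splits)
  have "trace ((adj B ** B) ** (adj B ** B)) = trace (adj B ** (B ** adj B ** B))"
    by (simp add: matrix_mul_assoc)
  also have "\<dots> = trace ((B ** adj B) ** (B ** adj B))"
    by (subst trace_mul_sym) (simp add: matrix_mul_assoc)
  finally have tr: "trace ((adj B ** B) ** (adj B ** B)) = trace ((B ** adj B) ** (B ** adj B))" .
  have sqrt2: "(sqrt 2 * u) * (sqrt 2 * v) = 2 * (u * v)" for u v :: real
    by simp
  have "2 * norm ((trace (A ** B))\<^sup>2 - trace ((A ** B) ** (A ** B)))
    \<le> 2 * (sqrt (Re ((trace (A ** adj A))\<^sup>2 - trace ((A ** adj A) ** (A ** adj A))))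
      * sqrt (Re ((trace (B ** adj B))\<^sup>2 - trace ((B ** adj B) ** (B ** adj B)))))"
    using * unfolding b norm_minors adj_adj tr trace_mul_sym[of "adj B" B] norm_mult norm_numeral sqrt2 .
  then show ?thesis by simp
qed

lemma superfidelity:
  fixes \<rho> \<sigma> :: "complex^'n^'n"
  assumes "\<rho> \<in> density_matrices" "\<sigma> \<in> density_matrices"
  shows "fidelity \<rho> \<sigma> \<le> Re (trace (\<rho> ** \<sigma>))
    + sqrt (1 - Re (trace (\<rho> ** \<rho>))) * sqrt (1 - Re (trace (\<sigma> ** \<sigma>)))"
proof -
  define P Q where "P = msqrt \<rho>" and "Q = msqrt \<sigma>"
  have psd: "psd \<rho>" "psd \<sigma>" and tr: "trace \<rho> = 1" "trace \<sigma> = 1"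
    using assms by (auto simp: density_matrices_def)
  have P: "adj P = P" "P ** P = \<rho>" and Q: "adj Q = Q" "Q ** Q = \<sigma>"
    using msqrt[OF psd(1)] msqrt[OF psd(2)] by (simp_all add: P_def Q_def psd_adj)
  obtain U where U: "unitary U" "psd ((P ** Q) ** U)"
    using polar[of "P ** Q"] by blast
  define X where "X = (P ** Q) ** U"
  have XX: "X ** X = P ** \<sigma> ** P"
    unfolding X_def unitary_polar_square[OF U] adj_mult P Q
    by (simp add: Q(2)[symmetric] matrix_mul_assoc)
  have fid: "fidelity \<rho> \<sigma> = (Re (trace X))\<^sup>2"
    using msqrt_eqI[OF U(2)] XX by (simp add: fidelity_def P_def X_def)
  \<comment> \<open>\<open>fidelity\<close> squares only the real part; reality of the trace
    identifies this with the complex square in the compound inequality.\<close>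
  have "Im (trace X) = 0"
  proof -
    have "X$i$i \<in> \<real>" for i
      using U(2) unfolding psd_iff X_def[symmetric] by (metis cinner_axis_left matrix_vector_axis)
    then show ?thesis by (simp add: trace_def complex_is_Real_iff)
  qed
  then have F: "(trace X)\<^sup>2 = of_real (fidelity \<rho> \<sigma>)"
    by (simp add: fid complex_eq_iff power2_eq_square)
  have "trace (X ** X) = trace (\<rho> ** \<sigma>)"
    unfolding XX by (subst trace_mul_sym) (simp add: matrix_mul_assoc P)
  with F have "fidelity \<rho> \<sigma> - Re (trace (\<rho> ** \<sigma>)) = Re ((trace X)\<^sup>2 - trace (X ** X))"
    by simp
  also have "\<dots> \<le> norm ((trace X)\<^sup>2 - trace (X ** X))"
    by (rule complex_Re_le_cmod)
  also have "\<dots> \<le> sqrt (1 - Re (trace (\<rho> ** \<rho>))) * sqrt (1 - Re (trace (\<sigma> ** \<sigma>)))"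
  proof -
    \<comment> \<open>The unitary is attached to \<open>Q\<close>, so the two factors of
      \<open>X\<close> have Gram matrices \<open>\<rho>\<close> and \<open>\<sigma>\<close>, each of
      trace 1.\<close>
    have "(Q ** U) ** adj (Q ** U) = Q ** (U ** adj U) ** adj Q"
      by (simp add: adj_mult matrix_mul_assoc)
    then have QU: "(Q ** U) ** adj (Q ** U) = \<sigma>"
      using U(1) Q by (simp add: unitary_def)
    have PQU: "P ** (Q ** U) = X"
      by (simp add: X_def matrix_mul_assoc)
    show ?thesis
      using trace_compound_Cauchy_Schwarz[of P "Q ** U"] unfolding QU PQU
      by (simp add: P tr)
  qed
  finally show ?thesis by simp
qed

section \<open>Real Hilbert-Schmidt geometry and averaging\<close>

lemma trace_eq_inner:
  fixes A B :: "complex^'n^'n"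
  assumes "adj B = B"
  shows "Re (trace (A ** B)) = A \<bullet> B"
proof -
  have "B$j$i = cnj (B$i$j)" for i j
    using assms by (metis (no_types, lifting) adj_def vec_lambda_beta)
  then have "trace (A ** B) = (\<Sum>i\<in>UNIV. \<Sum>j\<in>UNIV. A$i$j * cnj (B$i$j))"
    unfolding trace_def matrix_matrix_mult_def vec_lambda_beta by (intro sum.cong refl) metis
  then show ?thesis
    by (simp add: inner_vec_def inner_complex_def)
qed

lemma inner_mat_1: "A \<bullet> (mat 1 :: complex^'n^'n) = Re (trace A)"
  by (simp add: trace_eq_inner[symmetric])

text \<open>Cauchy-Schwarz on axis vectors bounds each squared entry by a product of diagonal
  entries, and these products sum to the squared trace. The bound gives integrability and keeps the
  roots of 1 - tr(rho^2) real.\<close>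

lemma density_norm_le_1:
  assumes "\<rho> \<in> density_matrices"
  shows "norm \<rho> \<le> 1"
proof -
  have r: "psd \<rho>" "trace \<rho> = 1" using assms by (auto simp: density_matrices_def)
  have "(norm \<rho>)\<^sup>2 = (\<Sum>i\<in>UNIV. \<Sum>j\<in>UNIV. (norm (\<rho>$i$j))\<^sup>2)"
    by (simp add: norm_vec_def L2_set_def sum_nonneg)
  also have "\<dots> \<le> (\<Sum>i\<in>UNIV. \<Sum>j\<in>UNIV. Re (\<rho>$i$i) * Re (\<rho>$j$j))"
    using psd_Cauchy_Schwarz[OF r(1), of "axis _ 1" "axis _ 1"]
    by (intro sum_mono) (simp add: cinner_axis_left matrix_vector_axis)
  also have "\<dots> = (Re (trace \<rho>))\<^sup>2"
    by (simp add: trace_def sum_product power2_eq_square)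
  finally show ?thesis
    using r(2) by (simp add: power_le_one_iff abs_square_le_1)
qed

theorem theorem3:
  fixes M :: "(complex^'n^'n) measure" and \<sigma> :: "complex^'n^'n"
  assumes "prob_space M"
    and "sets M = sets (restrict_space borel density_matrices)"
    and "\<sigma> \<in> density_matrices"
  shows "(\<integral>\<rho>. fidelity \<rho> \<sigma> \<partial>M)
    \<le> (1 / real CARD('n)) *
       (1 + sqrt (real CARD('n) - 1) *
          sqrt (real CARD('n) *
                  ((\<integral>\<rho>. sqrt (1 - Re (trace (\<rho> ** \<rho>))) \<partial>M) ^ 2
                   + Re (trace ((\<integral>\<rho>. \<rho> \<partial>M) ** (\<integral>\<rho>. \<rho> \<partial>M))))
                - 1))"
proof -
  interpret prob_space M by fact
  define d where "d = real CARD('n)"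
  have d: "1 \<le> d" using zero_less_card_finite[where 'a = 'n] by (simp add: d_def Suc_leI)
  have space: "space M = density_matrices"
    using sets_eq_imp_space_eq[OF assms(2)] by (simp add: space_restrict_space)
  define E where "E = (\<integral>\<rho>. \<rho> \<partial>M)"
  define purity_defect :: "complex^'n^'n \<Rightarrow> real"
    where "purity_defect \<rho> = sqrt (1 - Re (trace (\<rho> ** \<rho>)))" for \<rho>
  define a where "a = (\<integral>\<rho>. purity_defect \<rho> \<partial>M)"
  define s where "s = purity_defect \<sigma>"
  have dens: "adj \<rho> = \<rho>" "\<rho> \<bullet> mat 1 = 1" "Re (trace (\<rho> ** \<rho>)) = \<rho> \<bullet> \<rho>" "\<rho> \<bullet> \<rho> \<le> 1"
    if "\<rho> \<in> density_matrices" for \<rho> :: "complex^'n^'n"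
  proof -
    show adj: "adj \<rho> = \<rho>" and "\<rho> \<bullet> mat 1 = 1"
      using that by (simp_all add: density_matrices_def psd_adj inner_mat_1)
    show "Re (trace (\<rho> ** \<rho>)) = \<rho> \<bullet> \<rho>"
      by (rule trace_eq_inner[OF adj])
    show "\<rho> \<bullet> \<rho> \<le> 1"
      unfolding power2_norm_eq_inner[symmetric]
      by (rule power_le_one) (simp_all add: density_norm_le_1[OF that])
  qed
  have meas: "f \<in> borel_measurable M" if "continuous_on UNIV f"
    for f :: "complex^'n^'n \<Rightarrow> 'b :: topological_space"
    unfolding measurable_cong_sets[OF assms(2) refl]
    by (intro measurable_restrict_space1 borel_measurable_continuous_onI that)
  have int_id: "integrable M (\<lambda>\<rho>. \<rho>)"
    by (rule integrable_const_bound[of _ 1])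
      (auto intro!: meas AE_I2 simp: space density_norm_le_1)
  have int_defect: "integrable M purity_defect"
  proof (rule integrable_const_bound[of _ 1])
    show "AE \<rho> in M. norm (purity_defect \<rho>) \<le> 1"
      by (auto intro!: AE_I2 simp: space purity_defect_def dens)
    show "purity_defect \<in> borel_measurable M"
      unfolding purity_defect_def matrix_matrix_mult_def trace_def
      by (intro meas continuous_intros)
  qed
  have "adj E = E"
  proof -
    \<comment> \<open>Real linearity of the conjugate-linear \<open>adj\<close> is enough to pass it
      through the integral.\<close>
    have "bounded_linear (adj :: complex^'n^'n \<Rightarrow> _)"
      by (intro linear_conv_bounded_linear[THEN iffD1] linearI) (simp_all add: adj_def vec_eq_iff)
    then have "adj E = (\<integral>\<rho>. adj \<rho> \<partial>M)"
      unfolding E_def using int_id by (rule integral_bounded_linear[symmetric])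
    also have "\<dots> = E"
      unfolding E_def by (intro Bochner_Integration.integral_cong refl) (simp add: space dens)
    finally show ?thesis .
  qed
  then have trEE: "Re (trace (E ** E)) = E \<bullet> E" by (rule trace_eq_inner)
  have "E \<bullet> mat 1 = (\<integral>\<rho>. \<rho> \<bullet> mat 1 \<partial>M)"
    unfolding E_def using int_id by simp
  also have "\<dots> = (\<integral>\<rho>. 1 \<partial>M)"
    by (intro Bochner_Integration.integral_cong refl) (simp add: space dens)
  finally have E1: "E \<bullet> mat 1 = 1" by (simp add: prob_space)
  have a0: "0 \<le> a"
    unfolding a_def by (intro integral_nonneg_AE AE_I2) (simp add: space purity_defect_def dens)
  have s0: "0 \<le> s" "s\<^sup>2 = 1 - \<sigma> \<bullet> \<sigma>"
    using dens[OF assms(3)] by (simp_all add: s_def purity_defect_def)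
  have fid: "fidelity \<rho> \<sigma> \<le> \<rho> \<bullet> \<sigma> + purity_defect \<rho> * s" if "\<rho> \<in> space M" for \<rho>
    using superfidelity[OF _ assms(3), of \<rho>] that
    by (simp add: space purity_defect_def s_def trace_eq_inner dens(1)[OF assms(3)])
  \<comment> \<open>The fidelity need not be shown measurable: were it not integrable, its integral would be 0.\<close>
  have "(\<integral>\<rho>. fidelity \<rho> \<sigma> \<partial>M) \<le> (\<integral>\<rho>. \<rho> \<bullet> \<sigma> + purity_defect \<rho> * s \<partial>M)"
  proof (rule integral_mono')
    show "integrable M (\<lambda>\<rho>. \<rho> \<bullet> \<sigma> + purity_defect \<rho> * s)"
      using int_id int_defect by simp
    \<comment> \<open>The bound dominates a square, hence is nonnegative.\<close>
    show "0 \<le> \<rho> \<bullet> \<sigma> + purity_defect \<rho> * s" if "\<rho> \<in> space M" for \<rho>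
      using fid[OF that] by (rule order_trans[rotated]) (simp add: fidelity_def)
  qed (rule fid)
  also have "\<dots> = E \<bullet> \<sigma> + a * s"
    using int_id int_defect by (simp add: E_def a_def)
  also have "\<dots> \<le> 1 / d + sqrt (a\<^sup>2 + E \<bullet> E - 1 / d) * sqrt (1 - 1 / d)"
  proof -
    \<comment> \<open>The maximally mixed state. Subtracting it from a matrix of trace 1 leaves the
      traceless part.\<close>
    define I :: "complex^'n^'n" where "I = (1 / d) *\<^sub>R mat 1"
    have II: "(mat 1 :: complex^'n^'n) \<bullet> mat 1 = d"
      by (simp add: inner_mat_1 trace_I d_def)
    have shift: "(A - I) \<bullet> (B - I) = A \<bullet> B - 1 / d" if "A \<bullet> mat 1 = 1" "B \<bullet> mat 1 = 1" for A B
    proof -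
      have "A \<bullet> I = 1 / d" "I \<bullet> B = 1 / d" "I \<bullet> I = 1 / d"
        using d by (simp_all add: I_def that II inner_commute[of "mat 1" B])
      then show ?thesis by (simp add: inner_diff)
    qed
    have n: "(norm (A - I))\<^sup>2 = A \<bullet> A - 1 / d" if "A \<bullet> mat 1 = 1" for A
      using shift[OF that that] by (simp add: power2_norm_eq_inner)
    note \<sigma>1 = dens(2)[OF assms(3)]
    \<comment> \<open>Pairing each norm with the matching scalar makes the second Cauchy-Schwarz one
      in a product space.\<close>
    let ?x = "(norm (E - I), a)" and ?y = "(norm (\<sigma> - I), s)"
    have "E \<bullet> \<sigma> - 1 / d + a * s \<le> norm (E - I) * norm (\<sigma> - I) + a * s"
      using norm_cauchy_schwarz[of "E - I" "\<sigma> - I"] shift[OF E1 \<sigma>1] by simp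
    also have "\<dots> = ?x \<bullet> ?y" by (simp add: inner_prod_def)
    also have "\<dots> \<le> norm ?x * norm ?y" by (rule norm_cauchy_schwarz)
    \<comment> \<open>For \<open>?y\<close> the squared norm is (tr(sigma^2) - 1/d) + (1 -
      tr(sigma^2)), so the purity of \<open>\<sigma>\<close> cancels.\<close>
    also have "\<dots> = sqrt (a\<^sup>2 + E \<bullet> E - 1 / d) * sqrt (1 - 1 / d)"
      by (simp add: norm_prod_def n[OF E1] n[OF \<sigma>1] s0 algebra_simps)
    finally show ?thesis by simp
  qed
  also have "\<dots> = (1 / d) * (1 + sqrt (d - 1) * sqrt (d * (a\<^sup>2 + E \<bullet> E) - 1))"
  proof -
    \<comment> \<open>A factor \<open>sqrt d\<close> comes out of each root; together they cancel
      the prefactor \<open>1 / d\<close>.\<close>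
    have "sqrt (d - 1) * sqrt (d * (a\<^sup>2 + E \<bullet> E) - 1) =
        sqrt (d * (1 - 1 / d)) * sqrt (d * (a\<^sup>2 + E \<bullet> E - 1 / d))"
      using d by (simp add: right_diff_distrib)
    also have "\<dots> = (sqrt d * sqrt d) * (sqrt (1 - 1 / d) * sqrt (a\<^sup>2 + E \<bullet> E - 1 / d))"
      by (simp only: real_sqrt_mult mult_ac)
    finally show ?thesis
      using d by (simp add: field_simps)
  qed
  finally show ?thesis
    unfolding trEE[symmetric] by (simp only: a_def purity_defect_def E_def d_def)
qed

end
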